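(* Let $\mathcal C$ be a pointed category with finite limits. The following are equivalent: (i) $\mathcal C$ is prenormal; (ii) the pair $(\mathrm{NEpi},\mathrm{TKer})$ is a stable factorisation system on $\mathcal C$; (iii) $\mathcal C$ admits a stable factorisation system of the form $(\mathrm{NEpi},\mathscr M)$ for some class $\mathscr M$ of morphisms in $\mathcal C$; (iv) $\mathcal C$ admits a stable factorisation system of the form $(\mathscr E,\mathrm{TKer})$ for some class $\mathscr E$ of morphisms in $\mathcal C$.
   Context: A pointed category is a category with a zero object. In a pointed category $\mathcal C$: a normal epimorphism is a morphism that is a cokernel of some morphism; a normal monomorphism is a morphism that is a kernel of some morphism; $\mathrm{NEpi}$ is the class of normal epimorphisms of $\mathcal C$; $\mathrm{TKer}$ is the class of morphisms of $\mathcal C$ whose kernel is (reduced to) zero. A prenormal category is a pointed category $\mathcal C$ such that: (1) $\mathcal C$ has finite limits; (2) $\mathcal C$ has cokernels of kernels (every morphism which is a kernel has a cokernel); (3) normal epimorphisms are pullback-stable in $\mathcal C$ (the pullback of a normal epimorphism along any morphism is a normal epimorphism). A factorisation system on a category $\mathcal C$ is a pair $(\mathscr E,\mathscr M)$ of classes of morphisms such that: both classes are closed under composition with isomorphisms; every morphism $f$ factors as $f=m\circ e$ with $e\in\mathscr E$, $m\in\mathscr M$; and every $f\colon X\to Y$ in $\mathscr E$ is orthogonal to every $f'\colon X'\to Y'$ in $\mathscr M$, i.e. for all $x\colon X\to X'$, $y\colon Y\to Y'$ with $y\circ f=f'\circ x$ there is a unique $d\colon Y\to X'$ with $d\circ f=x$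 and $f'\circ d=y$. It is stable if the pullback of a morphism of $\mathscr E$ along any morphism of $\mathcal C$ is again in $\mathscr E$. *)

theory Defs
  imports Main
begin

record ('o, 'm) cat =
  Obj :: "'o set"
  Mor :: "'m set"
  Dom :: "'m \<Rightarrow> 'o"
  Cod :: "'m \<Rightarrow> 'o"
  Id :: "'o \<Rightarrow> 'm"
  Comp :: "'m \<Rightarrow> 'm \<Rightarrow> 'm" (infixr "\<cdot>\<index>" 70)

definition Hom :: "('o, 'm) cat \<Rightarrow> 'o \<Rightarrow> 'o \<Rightarrow> 'm set" where
  "Hom C A B = {f \<in> Mor C. Dom C f = A \<and> Cod C f = B}"

text \<open>
  Composition is in the usual applicative order: \<open>g \<cdot>\<^bsub>C\<^esub> f\<close> is \<open>g\<close> after \<open>f\<close>.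
  Outside the carriers, and on non-composable pairs, the operations are unconstrained.
\<close>

locale category =
  fixes C :: "('o, 'm) cat" (structure)
  assumes Dom_Obj: "f \<in> Mor C \<Longrightarrow> Dom C f \<in> Obj C"
    and Cod_Obj: "f \<in> Mor C \<Longrightarrow> Cod C f \<in> Obj C"
    and Id_Hom: "A \<in> Obj C \<Longrightarrow> Id C A \<in> Hom C A A"
    and Comp_Hom: "f \<in> Hom C A B \<Longrightarrow> g \<in> Hom C B D \<Longrightarrow> g \<cdot> f \<in> Hom C A D"
    and Id_left: "f \<in> Hom C A B \<Longrightarrow> Id C B \<cdot> f = f"
    and Id_right: "f \<in> Hom C A B \<Longrightarrow> f \<cdot> Id C A = f"
    and Comp_assoc: "f \<in> Hom C A B \<Longrightarrow> g \<in> Hom C B D \<Longrightarrow> h \<in> Hom C D E \<Longrightarrow>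
      (h \<cdot> g) \<cdot> f = h \<cdot> (g \<cdot> f)"

definition isomorphism :: "('o, 'm) cat \<Rightarrow> 'm \<Rightarrow> bool" where
  "isomorphism C f \<longleftrightarrow> f \<in> Mor C \<and>
    (\<exists>g \<in> Hom C (Cod C f) (Dom C f).
      g \<cdot>\<^bsub>C\<^esub> f = Id C (Dom C f) \<and> f \<cdot>\<^bsub>C\<^esub> g = Id C (Cod C f))"

definition is_functor ::
  "('i, 'j) cat \<Rightarrow> ('o, 'm) cat \<Rightarrow> ('i \<Rightarrow> 'o) \<Rightarrow> ('j \<Rightarrow> 'm) \<Rightarrow> bool" where
  "is_functor J C Fo Fm \<longleftrightarrow>
    (\<forall>i \<in> Obj J. Fo i \<in> Obj C) \<and>
    (\<forall>u \<in> Mor J. Fm u \<in> Hom C (Fo (Dom J u)) (Fo (Cod J u))) \<and>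
    (\<forall>i \<in> Obj J. Fm (Id J i) = Id C (Fo i)) \<and>
    (\<forall>u \<in> Mor J. \<forall>v \<in> Mor J. Dom J v = Cod J u \<longrightarrow>
      Fm (v \<cdot>\<^bsub>J\<^esub> u) = Fm v \<cdot>\<^bsub>C\<^esub> Fm u)"

definition is_cone ::
  "('i, 'j) cat \<Rightarrow> ('o, 'm) cat \<Rightarrow> ('i \<Rightarrow> 'o) \<Rightarrow> ('j \<Rightarrow> 'm) \<Rightarrow> 'o \<Rightarrow> ('i \<Rightarrow> 'm) \<Rightarrow> bool" where
  "is_cone J C Fo Fm A t \<longleftrightarrow> A \<in> Obj C \<and>
    (\<forall>i \<in> Obj J. t i \<in> Hom C A (Fo i)) \<and>
    (\<forall>u \<in> Mor J. Fm u \<cdot>\<^bsub>C\<^esub> t (Dom J u) = t (Cod J u))"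

definition is_limit ::
  "('i, 'j) cat \<Rightarrow> ('o, 'm) cat \<Rightarrow> ('i \<Rightarrow> 'o) \<Rightarrow> ('j \<Rightarrow> 'm) \<Rightarrow> 'o \<Rightarrow> ('i \<Rightarrow> 'm) \<Rightarrow> bool" where
  "is_limit J C Fo Fm A t \<longleftrightarrow> is_cone J C Fo Fm A t \<and>
    (\<forall>B s. is_cone J C Fo Fm B s \<longrightarrow>
      (\<exists>!h. h \<in> Hom C B A \<and> (\<forall>i \<in> Obj J. t i \<cdot>\<^bsub>C\<^esub> h = s i)))"

text \<open>
  Every finite category is isomorphic to one whose objects and morphisms are natural
  numbers, so it is enough to let the shapes of the diagrams range over these.
\<close>

definition has_finite_limits :: "('o, 'm) cat \<Rightarrow> bool" where
  "has_finite_limits C \<longleftrightarrow>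
    (\<forall>(J :: (nat, nat) cat) Fo Fm.
      category J \<and> finite (Obj J) \<and> finite (Mor J) \<and> is_functor J C Fo Fm \<longrightarrow>
      (\<exists>A t. is_limit J C Fo Fm A t))"

text \<open>
  \<open>is_pullback C f g p q\<close>: the square \<open>f \<cdot> p = g \<cdot> q\<close> is a pullback. Then \<open>q\<close> is the
  pullback of \<open>f\<close> along \<open>g\<close>.
\<close>

definition is_pullback :: "('o, 'm) cat \<Rightarrow> 'm \<Rightarrow> 'm \<Rightarrow> 'm \<Rightarrow> 'm \<Rightarrow> bool" where
  "is_pullback C f g p q \<longleftrightarrow>
    f \<in> Mor C \<and> g \<in> Mor C \<and> Cod C f = Cod C g \<and>
    p \<in> Mor C \<and> q \<in> Mor C \<and> Dom C p = Dom C q \<and>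
    Cod C p = Dom C f \<and> Cod C q = Dom C g \<and>
    f \<cdot>\<^bsub>C\<^esub> p = g \<cdot>\<^bsub>C\<^esub> q \<and>
    (\<forall>T \<in> Obj C. \<forall>a \<in> Hom C T (Dom C f). \<forall>b \<in> Hom C T (Dom C g).
      f \<cdot>\<^bsub>C\<^esub> a = g \<cdot>\<^bsub>C\<^esub> b \<longrightarrow>
      (\<exists>!h. h \<in> Hom C T (Dom C p) \<and> p \<cdot>\<^bsub>C\<^esub> h = a \<and> q \<cdot>\<^bsub>C\<^esub> h = b))"

definition pullback_stable :: "('o, 'm) cat \<Rightarrow> 'm set \<Rightarrow> bool" where
  "pullback_stable C S \<longleftrightarrow> (\<forall>f g p q. f \<in> S \<and> is_pullback C f g p q \<longrightarrow> q \<in> S)"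

definition zero_object :: "('o, 'm) cat \<Rightarrow> 'o \<Rightarrow> bool" where
  "zero_object C Z \<longleftrightarrow> Z \<in> Obj C \<and>
    (\<forall>A \<in> Obj C. (\<exists>!f. f \<in> Hom C A Z) \<and> (\<exists>!f. f \<in> Hom C Z A))"

definition pointed_category :: "('o, 'm) cat \<Rightarrow> bool" where
  "pointed_category C \<longleftrightarrow> category C \<and> (\<exists>Z. zero_object C Z)"

definition zero_morphism :: "('o, 'm) cat \<Rightarrow> 'm \<Rightarrow> bool" where
  "zero_morphism C f \<longleftrightarrow> f \<in> Mor C \<and>
    (\<exists>Z. zero_object C Z \<and>
      (\<exists>g \<in> Hom C (Dom C f) Z. \<exists>h \<in> Hom C Z (Cod C f). f = h \<cdot>\<^bsub>C\<^esub> g))"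

definition is_kernel :: "('o, 'm) cat \<Rightarrow> 'm \<Rightarrow> 'm \<Rightarrow> bool" where
  "is_kernel C k f \<longleftrightarrow> k \<in> Mor C \<and> f \<in> Mor C \<and> Cod C k = Dom C f \<and>
    zero_morphism C (f \<cdot>\<^bsub>C\<^esub> k) \<and>
    (\<forall>g \<in> Mor C. Cod C g = Dom C f \<and> zero_morphism C (f \<cdot>\<^bsub>C\<^esub> g) \<longrightarrow>
      (\<exists>!u. u \<in> Hom C (Dom C g) (Dom C k) \<and> k \<cdot>\<^bsub>C\<^esub> u = g))"

definition is_cokernel :: "('o, 'm) cat \<Rightarrow> 'm \<Rightarrow> 'm \<Rightarrow> bool" where
  "is_cokernel C q f \<longleftrightarrow> q \<in> Mor C \<and> f \<in> Mor C \<and> Dom C q = Cod C f \<and>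
    zero_morphism C (q \<cdot>\<^bsub>C\<^esub> f) \<and>
    (\<forall>g \<in> Mor C. Dom C g = Cod C f \<and> zero_morphism C (g \<cdot>\<^bsub>C\<^esub> f) \<longrightarrow>
      (\<exists>!u. u \<in> Hom C (Cod C q) (Cod C g) \<and> u \<cdot>\<^bsub>C\<^esub> q = g))"

definition NEpi :: "('o, 'm) cat \<Rightarrow> 'm set" where
  "NEpi C = {q. \<exists>f. is_cokernel C q f}"

definition TKer :: "('o, 'm) cat \<Rightarrow> 'm set" where
  "TKer C = {f. \<exists>k. is_kernel C k f \<and> zero_object C (Dom C k)}"

definition prenormal :: "('o, 'm) cat \<Rightarrow> bool" where
  "prenormal C \<longleftrightarrow> pointed_category C \<and> has_finite_limits C \<and>
    (\<forall>k f. is_kernel C k f \<longrightarrow> (\<exists>q. is_cokernel C q k)) \<and>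
    pullback_stable C (NEpi C)"

definition iso_closed :: "('o, 'm) cat \<Rightarrow> 'm set \<Rightarrow> bool" where
  "iso_closed C S \<longleftrightarrow>
    (\<forall>f \<in> S. \<forall>i. isomorphism C i \<longrightarrow>
      (Dom C i = Cod C f \<longrightarrow> i \<cdot>\<^bsub>C\<^esub> f \<in> S) \<and> (Cod C i = Dom C f \<longrightarrow> f \<cdot>\<^bsub>C\<^esub> i \<in> S))"

definition orthogonal :: "('o, 'm) cat \<Rightarrow> 'm \<Rightarrow> 'm \<Rightarrow> bool" where
  "orthogonal C f f' \<longleftrightarrow>
    (\<forall>x \<in> Hom C (Dom C f) (Dom C f'). \<forall>y \<in> Hom C (Cod C f) (Cod C f').
      y \<cdot>\<^bsub>C\<^esub> f = f' \<cdot>\<^bsub>C\<^esub> x \<longrightarrow>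
      (\<exists>!d. d \<in> Hom C (Cod C f) (Dom C f') \<and> d \<cdot>\<^bsub>C\<^esub> f = x \<and> f' \<cdot>\<^bsub>C\<^esub> d = y))"

definition factorisation_system :: "('o, 'm) cat \<Rightarrow> 'm set \<Rightarrow> 'm set \<Rightarrow> bool" where
  "factorisation_system C E M \<longleftrightarrow>
    E \<subseteq> Mor C \<and> M \<subseteq> Mor C \<and>
    iso_closed C E \<and> iso_closed C M \<and>
    (\<forall>f \<in> Mor C. \<exists>e \<in> E. \<exists>m \<in> M. Cod C e = Dom C m \<and> f = m \<cdot>\<^bsub>C\<^esub> e) \<and>
    (\<forall>e \<in> E. \<forall>m \<in> M. orthogonal C e m)"

definition stable_factorisation_system :: "('o, 'm) cat \<Rightarrow> 'm set \<Rightarrow> 'm set \<Rightarrow> bool" where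
  "stable_factorisation_system C E M \<longleftrightarrow> factorisation_system C E M \<and> pullback_stable C E"

end

theory Submission
  imports Defs
begin

text \<open>
  The morphisms with trivial kernel are exactly those that reflect zero morphisms under
  post-composition (\<open>TKer_iff\<close>). A normal epimorphism \<open>q\<close>, a cokernel of \<open>h\<close> say, is therefore
  orthogonal to each \<open>m\<close> with trivial kernel: in a square \<open>y \<cdot> q = m \<cdot> x\<close> the composite
  \<open>m \<cdot> x \<cdot> h = y \<cdot> q \<cdot> h\<close> is zero, so \<open>x \<cdot> h\<close> is zero and \<open>x\<close> factors through \<open>q\<close>
  (\<open>NEpi_orthogonal_TKer\<close>). What varies between the four conditions is only the supply of
  factorisations, and three arguments close the circle.

  If \<open>C\<close> is prenormal, factor \<open>f = m \<cdot> e\<close> with \<open>e\<close> the cokernel of the kernel of \<open>f\<close>. Pull \<open>e\<close> back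
  along the kernel \<open>l\<close> of \<open>m\<close>, to a morphism \<open>q\<close> onto the domain of \<open>l\<close>. The other projection of
  the pullback is killed by \<open>f\<close>, so it factors through the kernel of \<open>f\<close>, so it is killed by \<open>e\<close>;
  hence \<open>q\<close> is zero. But \<open>q\<close> is a normal epimorphism by stability, and a zero epimorphism has a
  zero codomain: \<open>m\<close> has trivial kernel (\<open>cokernel_of_kernel_comparison_TKer\<close>).

  If \<open>NEpi\<close> is the left class of a factorisation system, the right class lies in \<open>TKer\<close>, because it
  is orthogonal to morphisms into a zero object. So the normal epimorphism \<open>e\<close> in a factorisation
  \<open>f = m \<cdot> e\<close> has the same kernel as \<open>f\<close>; and a normal epimorphism is the cokernel of its kernel
  (\<open>cokernel_of_kernel_if_NEpi_left_class\<close>).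

  If \<open>(E, TKer)\<close> is a stable factorisation system, then \<open>E = NEpi\<close>. The inclusion of \<open>NEpi\<close> in \<open>E\<close>
  is the orthogonality above. Conversely let \<open>e\<close> belong to \<open>E\<close> and let \<open>g\<close> kill the kernel of \<open>e\<close>.
  Factor the pair \<open>(e, g)\<close>, a morphism into the product of the two codomains, as \<open>(a, b) \<cdot> c\<close> with
  \<open>c\<close> in \<open>E\<close> and \<open>(a, b)\<close> in \<open>TKer\<close>; a pullback argument like the one for prenormal categories
  shows that already \<open>a\<close> is in \<open>TKer\<close>. Orthogonality applied to \<open>e = a \<cdot> c\<close> gives \<open>d\<close> with
  \<open>d \<cdot> e = c\<close>, and \<open>(b \<cdot> d) \<cdot> e = b \<cdot> c = g\<close> (\<open>left_class_of_TKer_subset_NEpi\<close>).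
\<close>

section \<open>Zero morphisms\<close>

locale pointed_cat = category +
  assumes zero_object_exists: "\<exists>Z. zero_object C Z"
begin

lemma MorD: "f \<in> Mor C \<Longrightarrow> f \<in> Hom C (Dom C f) (Cod C f)"
  by (simp add: Hom_def)

lemma HomD:
  assumes "f \<in> Hom C A B"
  shows "f \<in> Mor C" "Dom C f = A" "Cod C f = B" "A \<in> Obj C" "B \<in> Obj C"
  using assms Dom_Obj Cod_Obj by (auto simp: Hom_def)

lemma zero_morphismE:
  assumes "zero_morphism C f" "f \<in> Hom C A B"
  obtains Z g h where "zero_object C Z" "g \<in> Hom C A Z" "h \<in> Hom C Z B" "f = h \<cdot> g"
  using assms HomD unfolding zero_morphism_def by metis

lemma zero_morphismI:
  assumes "zero_object C Z" "g \<in> Hom C A Z" "h \<in> Hom C Z B"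
  shows "zero_morphism C (h \<cdot> g)"
  using assms HomD[OF Comp_Hom[OF assms(2,3)]] unfolding zero_morphism_def by metis

lemma zero_morphism_comp_left:
  assumes "zero_morphism C f" "f \<in> Hom C A B" "g \<in> Hom C B D"
  shows "zero_morphism C (g \<cdot> f)"
proof -
  obtain Z u v where f: "zero_object C Z" "u \<in> Hom C A Z" "v \<in> Hom C Z B" "f = v \<cdot> u"
    using assms zero_morphismE by blast
  show ?thesis
    using zero_morphismI[OF f(1,2) Comp_Hom[OF f(3) assms(3)]] Comp_assoc[OF f(2,3) assms(3)] f(4)
    by simp
qed

lemma zero_morphism_comp_right:
  assumes "zero_morphism C g" "f \<in> Hom C A B" "g \<in> Hom C B D"
  shows "zero_morphism C (g \<cdot> f)"
proof -
  obtain Z u v where g: "zero_object C Z" "u \<in> Hom C B Z" "v \<in> Hom C Z D" "g = v \<cdot> u"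
    using assms zero_morphismE by blast
  show ?thesis
    using zero_morphismI[OF g(1) Comp_Hom[OF assms(2) g(2)] g(3)] Comp_assoc[OF assms(2) g(2,3)] g(4)
    by simp
qed

lemma to_zero_object: "zero_object C Z \<Longrightarrow> A \<in> Obj C \<Longrightarrow> \<exists>f. f \<in> Hom C A Z"
  and from_zero_object: "zero_object C Z \<Longrightarrow> A \<in> Obj C \<Longrightarrow> \<exists>f. f \<in> Hom C Z A"
  unfolding zero_object_def by blast+

lemma to_zero_object_unique:
    "zero_object C Z \<Longrightarrow> f \<in> Hom C A Z \<Longrightarrow> g \<in> Hom C A Z \<Longrightarrow> f = g"
  and from_zero_object_unique:
    "zero_object C Z \<Longrightarrow> f \<in> Hom C Z A \<Longrightarrow> g \<in> Hom C Z A \<Longrightarrow> f = g"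
  unfolding zero_object_def by (metis HomD(4,5))+

lemma zero_object_Obj: "zero_object C Z \<Longrightarrow> Z \<in> Obj C"
  by (simp add: zero_object_def)

lemma zero_morphism_unique:
  assumes "zero_morphism C f" "f \<in> Hom C A B" "zero_morphism C g" "g \<in> Hom C A B"
  shows "f = g"
proof -
  obtain Z u v where f: "zero_object C Z" "u \<in> Hom C A Z" "v \<in> Hom C Z B" "f = v \<cdot> u"
    using assms zero_morphismE by blast
  obtain Z' u' v' where g: "zero_object C Z'" "u' \<in> Hom C A Z'" "v' \<in> Hom C Z' B" "g = v' \<cdot> u'"
    using assms zero_morphismE by blast
  obtain i where i: "i \<in> Hom C Z Z'"
    using to_zero_object f(1) g(1) zero_object_Obj by metis
  have "i \<cdot> u = u'" "v' \<cdot> i = v"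
    using to_zero_object_unique from_zero_object_unique f g i Comp_Hom by metis+
  then show ?thesis
    using f g i Comp_assoc by metis
qed

lemma zero_morphism_exists:
  assumes "A \<in> Obj C" "B \<in> Obj C"
  shows "\<exists>f \<in> Hom C A B. zero_morphism C f"
  using assms zero_object_exists to_zero_object from_zero_object zero_morphismI Comp_Hom by metis

lemma zero_morphism_to_zero_object:
  assumes "zero_object C Z" "f \<in> Hom C A Z"
  shows "zero_morphism C f"
  using zero_morphismI[OF assms, of "Id C Z" Z] assms Id_Hom Id_left zero_object_Obj by metis

lemma zero_morphism_from_zero_object:
  assumes "zero_object C Z" "f \<in> Hom C Z A"
  shows "zero_morphism C f"
  using zero_morphismI[OF assms(1) _ assms(2), of "Id C Z" Z] assms Id_Hom Id_right zero_object_Obj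
  by metis

lemma zero_object_if_zero_Id:
  assumes "L \<in> Obj C" "zero_morphism C (Id C L)"
  shows "zero_object C L"
  unfolding zero_object_def
proof (intro conjI ballI assms(1))
  fix A assume A: "A \<in> Obj C"
  have "zero_morphism C f" if "f \<in> Hom C A L" for f
    using that zero_morphism_comp_right[of "Id C L" f A L L] assms Id_Hom Id_left by metis
  then show "\<exists>!f. f \<in> Hom C A L"
    using zero_morphism_unique zero_morphism_exists A assms(1) by metis
  have "zero_morphism C f" if "f \<in> Hom C L A" for f
    using that zero_morphism_comp_left[of "Id C L" L L f A] assms Id_Hom Id_right by metis
  then show "\<exists>!f. f \<in> Hom C L A"
    using zero_morphism_unique zero_morphism_exists A assms(1) by metis
qed

section \<open>Kernels, cokernels and the classes they define\<close>

lemma kernelD: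
  assumes "is_kernel C k f" "f \<in> Hom C A B"
  shows "k \<in> Hom C (Dom C k) A" "zero_morphism C (f \<cdot> k)"
  using assms unfolding is_kernel_def Hom_def by auto

lemma kernel_factor:
  assumes "is_kernel C k f" "f \<in> Hom C A B" "g \<in> Hom C T A" "zero_morphism C (f \<cdot> g)"
  shows "\<exists>u \<in> Hom C T (Dom C k). k \<cdot> u = g"
  using assms HomD[OF assms(2)] HomD[OF assms(3)] unfolding is_kernel_def by metis

lemma kernelI:
  assumes "k \<in> Hom C K A" "f \<in> Hom C A B" "zero_morphism C (f \<cdot> k)"
    and "\<And>T g. g \<in> Hom C T A \<Longrightarrow> zero_morphism C (f \<cdot> g) \<Longrightarrow>
      \<exists>!u. u \<in> Hom C T K \<and> k \<cdot> u = g"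
  shows "is_kernel C k f"
  using assms HomD[OF assms(1)] HomD[OF assms(2)] MorD unfolding is_kernel_def by metis

lemma kernel_monic:
  assumes "is_kernel C k f" "f \<in> Hom C A B"
    and "u \<in> Hom C T (Dom C k)" "v \<in> Hom C T (Dom C k)" "k \<cdot> u = k \<cdot> v"
  shows "u = v"
proof -
  note k = kernelD[OF assms(1,2)]
  have ku: "k \<cdot> u \<in> Hom C T A"
    using Comp_Hom assms(3) k(1) by blast
  have "zero_morphism C (f \<cdot> (k \<cdot> u))"
    using zero_morphism_comp_right[OF k(2) assms(3) Comp_Hom[OF k(1) assms(2)]]
      Comp_assoc[OF assms(3) k(1) assms(2)] by metis
  then have "\<exists>!w. w \<in> Hom C T (Dom C k) \<and> k \<cdot> w = k \<cdot> u"
    using assms(1) HomD[OF assms(2)] HomD[OF ku] unfolding is_kernel_def by metis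
  then show ?thesis
    using assms by metis
qed

lemma kernel_cancel_zero:
  assumes "is_kernel C k f" "f \<in> Hom C A B" "e \<in> Hom C T (Dom C k)" "zero_morphism C (k \<cdot> e)"
  shows "zero_morphism C e"
proof -
  note k = kernelD[OF assms(1,2)]
  obtain z where z: "z \<in> Hom C T (Dom C k)" "zero_morphism C z"
    using zero_morphism_exists HomD(4,5)[OF assms(3)] by metis
  have "k \<cdot> z = k \<cdot> e"
    using zero_morphism_unique[OF zero_morphism_comp_left[OF z(2,1) k(1)] Comp_Hom[OF z(1) k(1)]
        assms(4) Comp_Hom[OF assms(3) k(1)]] .
  then show ?thesis
    using kernel_monic z assms by metis
qed

lemma cokernelD:
  assumes "is_cokernel C q f" "q \<in> Hom C A B"
  shows "f \<in> Hom C (Dom C f) A" "zero_morphism C (q \<cdot> f)"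
  using assms unfolding is_cokernel_def Hom_def by auto

lemma cokernel_factor:
  assumes "is_cokernel C q f" "q \<in> Hom C A B" "g \<in> Hom C A T" "zero_morphism C (g \<cdot> f)"
  shows "\<exists>u \<in> Hom C B T. u \<cdot> q = g"
  using assms HomD[OF assms(2)] HomD[OF assms(3)] unfolding is_cokernel_def by metis

lemma cokernelI:
  assumes "f \<in> Hom C K A" "q \<in> Hom C A B" "zero_morphism C (q \<cdot> f)"
    and "\<And>T g. g \<in> Hom C A T \<Longrightarrow> zero_morphism C (g \<cdot> f) \<Longrightarrow>
      \<exists>!u. u \<in> Hom C B T \<and> u \<cdot> q = g"
  shows "is_cokernel C q f"
  using assms HomD[OF assms(1)] HomD[OF assms(2)] MorD unfolding is_cokernel_def by metis

lemma cokernel_epic: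
  assumes "is_cokernel C q f" "q \<in> Hom C A B"
    and "u \<in> Hom C B T" "v \<in> Hom C B T" "u \<cdot> q = v \<cdot> q"
  shows "u = v"
proof -
  note q = cokernelD[OF assms(1,2)]
  have uq: "u \<cdot> q \<in> Hom C A T"
    using Comp_Hom assms by blast
  have "zero_morphism C ((u \<cdot> q) \<cdot> f)"
    using zero_morphism_comp_left[OF q(2) Comp_Hom[OF q(1) assms(2)] assms(3)]
      Comp_assoc[OF q(1) assms(2,3)] by metis
  then have "\<exists>!w. w \<in> Hom C B T \<and> w \<cdot> q = u \<cdot> q"
    using assms(1) HomD[OF assms(2)] HomD[OF uq] unfolding is_cokernel_def by metis
  then show ?thesis
    using assms by metis
qed

lemma NEpi_Mor: "NEpi C \<subseteq> Mor C"
  unfolding NEpi_def is_cokernel_def by blast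

lemma TKer_Mor: "TKer C \<subseteq> Mor C"
  unfolding TKer_def is_kernel_def by blast

text \<open>
  Trivial kernel as a cancellation property, free of any chosen kernel. If \<open>f\<close> has the property, the
  morphism from any zero object is a kernel of \<open>f\<close>.
\<close>

lemma TKer_iff:
  assumes f: "f \<in> Hom C A B"
  shows "f \<in> TKer C \<longleftrightarrow>
    (\<forall>T. \<forall>g \<in> Hom C T A. zero_morphism C (f \<cdot> g) \<longrightarrow> zero_morphism C g)"
proof
  assume "f \<in> TKer C"
  then obtain k where k: "is_kernel C k f" "zero_object C (Dom C k)"
    unfolding TKer_def by blast
  show "\<forall>T. \<forall>g \<in> Hom C T A. zero_morphism C (f \<cdot> g) \<longrightarrow> zero_morphism C g"
    using kernel_factor[OF k(1) f] kernelD[OF k(1) f] k(2) zero_morphismI by metis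
next
  assume refl: "\<forall>T. \<forall>g \<in> Hom C T A. zero_morphism C (f \<cdot> g) \<longrightarrow> zero_morphism C g"
  obtain Z where Z: "zero_object C Z"
    using zero_object_exists by blast
  obtain k where k: "k \<in> Hom C Z A"
    using from_zero_object Z HomD(4)[OF f] by blast
  have "is_kernel C k f"
  proof (rule kernelI[OF k f])
    show "zero_morphism C (f \<cdot> k)"
      using zero_morphism_from_zero_object Z Comp_Hom k f by blast
  next
    fix T g assume g: "g \<in> Hom C T A" "zero_morphism C (f \<cdot> g)"
    then obtain u where u: "u \<in> Hom C T Z"
      using to_zero_object Z HomD(4) by metis
    have "k \<cdot> u = g"
      using zero_morphism_unique[OF zero_morphismI[OF Z u k] Comp_Hom[OF u k] _ g(1)] refl g by blast
    then show "\<exists>!u. u \<in> Hom C T Z \<and> k \<cdot> u = g"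
      using u to_zero_object_unique Z by metis
  qed
  then show "f \<in> TKer C"
    using Z HomD(2)[OF k] unfolding TKer_def by blast
qed

lemma TKer_cancel_zero:
  assumes "f \<in> TKer C" "f \<in> Hom C A B" "g \<in> Hom C T A" "zero_morphism C (f \<cdot> g)"
  shows "zero_morphism C g"
  using assms TKer_iff by blast

lemma monic_in_TKer:
  assumes m: "m \<in> Hom C A B"
    and monic: "\<And>T u v. u \<in> Hom C T A \<Longrightarrow> v \<in> Hom C T A \<Longrightarrow> m \<cdot> u = m \<cdot> v \<Longrightarrow> u = v"
  shows "m \<in> TKer C"
  unfolding TKer_iff[OF m]
proof (intro allI ballI impI)
  fix T g assume g: "g \<in> Hom C T A" "zero_morphism C (m \<cdot> g)"
  obtain z where z: "z \<in> Hom C T A" "zero_morphism C z"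
    using zero_morphism_exists HomD(4,5) g(1) by metis
  have "m \<cdot> g = m \<cdot> z"
    using zero_morphism_unique[OF g(2) Comp_Hom[OF g(1) m] zero_morphism_comp_left[OF z(2,1) m]
        Comp_Hom[OF z(1) m]] .
  then show "zero_morphism C g"
    using monic g z by metis
qed

lemma isomorphismE:
  assumes "isomorphism C i"
  obtains A B j where "i \<in> Hom C A B" "j \<in> Hom C B A" "j \<cdot> i = Id C A" "i \<cdot> j = Id C B"
  using assms MorD unfolding isomorphism_def by metis

lemma iso_closed_TKer: "iso_closed C (TKer C)"
  unfolding iso_closed_def
proof (intro ballI allI impI conjI)
  fix f i assume fT: "f \<in> TKer C" and i: "isomorphism C i"
  have f: "f \<in> Hom C (Dom C f) (Cod C f)"
    using fT TKer_Mor MorD by blast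
  obtain A B j where ij: "i \<in> Hom C A B" "j \<in> Hom C B A" "j \<cdot> i = Id C A" "i \<cdot> j = Id C B"
    using i isomorphismE by blast
  {
    assume "Dom C i = Cod C f"
    then have i: "i \<in> Hom C (Cod C f) B" and j: "j \<in> Hom C B (Cod C f)"
      and ji: "j \<cdot> i = Id C (Cod C f)"
      using ij HomD(2)[OF ij(1)] by auto
    show "i \<cdot> f \<in> TKer C"
      unfolding TKer_iff[OF Comp_Hom[OF f i]]
    proof (intro allI ballI impI)
      fix T g assume g: "g \<in> Hom C T (Dom C f)" "zero_morphism C ((i \<cdot> f) \<cdot> g)"
      have fg: "f \<cdot> g \<in> Hom C T (Cod C f)"
        using Comp_Hom f g by blast
      have "zero_morphism C (j \<cdot> (i \<cdot> (f \<cdot> g)))"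
        using zero_morphism_comp_left g j Comp_assoc[OF g(1) f i] Comp_Hom[OF fg i] by metis
      then have "zero_morphism C (f \<cdot> g)"
        using Comp_assoc[OF fg i j] ji Id_left fg by metis
      then show "zero_morphism C g"
        using TKer_cancel_zero fT f g by blast
    qed
  next
    assume "Cod C i = Dom C f"
    then have i: "i \<in> Hom C A (Dom C f)" and j: "j \<in> Hom C (Dom C f) A"
      and ji: "j \<cdot> i = Id C A"
      using ij HomD(3)[OF ij(1)] by auto
    show "f \<cdot> i \<in> TKer C"
      unfolding TKer_iff[OF Comp_Hom[OF i f]]
    proof (intro allI ballI impI)
      fix T g assume g: "g \<in> Hom C T A" "zero_morphism C ((f \<cdot> i) \<cdot> g)"
      have ig: "i \<cdot> g \<in> Hom C T (Dom C f)"
        using Comp_Hom i g by blast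
      have "zero_morphism C (i \<cdot> g)"
        using TKer_cancel_zero[OF fT f ig] g Comp_assoc[OF g(1) i f] by metis
      then have "zero_morphism C (j \<cdot> (i \<cdot> g))"
        using zero_morphism_comp_left ig j by metis
      then show "zero_morphism C g"
        using Comp_assoc[OF g(1) i j] ji Id_left g by metis
    qed
  }
qed

lemma iso_closed_NEpi: "iso_closed C (NEpi C)"
  unfolding iso_closed_def
proof (intro ballI allI impI conjI)
  fix q i assume qN: "q \<in> NEpi C" and i: "isomorphism C i"
  have q: "q \<in> Hom C (Dom C q) (Cod C q)"
    using qN NEpi_Mor MorD by blast
  obtain f where cok: "is_cokernel C q f"
    using qN unfolding NEpi_def by blast
  note f = cokernelD[OF cok q]
  obtain A B j where ij: "i \<in> Hom C A B" "j \<in> Hom C B A" "j \<cdot> i = Id C A" "i \<cdot> j = Id C B"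
    using i isomorphismE by blast
  {
    assume "Dom C i = Cod C q"
    then have i: "i \<in> Hom C (Cod C q) B" and j: "j \<in> Hom C B (Cod C q)"
      and ji: "j \<cdot> i = Id C (Cod C q)" and ij': "i \<cdot> j = Id C B"
      using ij HomD(2)[OF ij(1)] by auto
    have "is_cokernel C (i \<cdot> q) f"
    proof (rule cokernelI[OF f(1) Comp_Hom[OF q i]])
      show "zero_morphism C ((i \<cdot> q) \<cdot> f)"
        using zero_morphism_comp_left[OF f(2) Comp_Hom[OF f(1) q] i] Comp_assoc[OF f(1) q i] by metis
    next
      fix T g assume g: "g \<in> Hom C (Dom C q) T" "zero_morphism C (g \<cdot> f)"
      obtain u where u: "u \<in> Hom C (Cod C q) T" "u \<cdot> q = g"
        using cokernel_factor cok q g by blast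
      have uj: "u \<cdot> j \<in> Hom C B T"
        using Comp_Hom u j by blast
      have "(u \<cdot> j) \<cdot> (i \<cdot> q) = ((u \<cdot> j) \<cdot> i) \<cdot> q"
        using Comp_assoc[OF q i uj] by simp
      also have "\<dots> = g"
        using Comp_assoc[OF i j u(1)] ji Id_right u by metis
      finally have "(u \<cdot> j) \<cdot> (i \<cdot> q) = g" .
      moreover have "v = u \<cdot> j" if v: "v \<in> Hom C B T" "v \<cdot> (i \<cdot> q) = g" for v
      proof -
        have "v \<cdot> i = u"
          using cokernel_epic[OF cok q Comp_Hom[OF i v(1)] u(1)] Comp_assoc[OF q i v(1)] v u by metis
        then show ?thesis
          using Comp_assoc[OF j i v(1)] ij' Id_right v by metis
      qed
      ultimately show "\<exists>!u. u \<in> Hom C B T \<and> u \<cdot> (i \<cdot> q) = g"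
        using uj by blast
    qed
    then show "i \<cdot> q \<in> NEpi C"
      unfolding NEpi_def by blast
  next
    assume "Cod C i = Dom C q"
    then have i: "i \<in> Hom C A (Dom C q)" and j: "j \<in> Hom C (Dom C q) A"
      and ji: "j \<cdot> i = Id C A" and ij': "i \<cdot> j = Id C (Dom C q)"
      using ij HomD(3)[OF ij(1)] by auto
    have jf: "j \<cdot> f \<in> Hom C (Dom C f) A"
      using Comp_Hom f j by blast
    have ijf: "i \<cdot> (j \<cdot> f) = f"
      using Comp_assoc[OF f(1) j i] ij' Id_left f by metis
    have "is_cokernel C (q \<cdot> i) (j \<cdot> f)"
    proof (rule cokernelI[OF jf Comp_Hom[OF i q]])
      show "zero_morphism C ((q \<cdot> i) \<cdot> (j \<cdot> f))"
        using Comp_assoc[OF jf i q] ijf f by metis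
    next
      fix T g assume g: "g \<in> Hom C A T" "zero_morphism C (g \<cdot> (j \<cdot> f))"
      have gj: "g \<cdot> j \<in> Hom C (Dom C q) T"
        using Comp_Hom g j by blast
      have "zero_morphism C ((g \<cdot> j) \<cdot> f)"
        using Comp_assoc[OF f(1) j g(1)] g by metis
      then obtain u where u: "u \<in> Hom C (Cod C q) T" "u \<cdot> q = g \<cdot> j"
        using cokernel_factor cok q gj by blast
      have "u \<cdot> (q \<cdot> i) = g"
        using Comp_assoc[OF i q u(1)] Comp_assoc[OF i j g(1)] u ji Id_right g by metis
      moreover have "v = u" if v: "v \<in> Hom C (Cod C q) T" "v \<cdot> (q \<cdot> i) = g" for v
      proof -
        have vq: "v \<cdot> q \<in> Hom C (Dom C q) T"
          using Comp_Hom v q by blast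
        have "v \<cdot> q = g \<cdot> j"
          using Comp_assoc[OF i q v(1)] Comp_assoc[OF j i vq] ij' Id_right vq v by metis
        then show ?thesis
          using cokernel_epic cok q u v by metis
      qed
      ultimately show "\<exists>!u. u \<in> Hom C (Cod C q) T \<and> u \<cdot> (q \<cdot> i) = g"
        using u by blast
    qed
    then show "q \<cdot> i \<in> NEpi C"
      unfolding NEpi_def by blast
  }
qed

text \<open>
  The diagonal comes from the cokernel property of \<open>q\<close>, once the top edge \<open>x\<close> is known to kill what
  \<open>q\<close> kills; the morphism \<open>m\<close> reflects this from the equation \<open>y \<cdot> q = m \<cdot> x\<close>. The lower triangle
  and uniqueness hold because \<open>q\<close> is epic.
\<close>

lemma NEpi_orthogonal_TKer:
  assumes qN: "q \<in> NEpi C" and mT: "m \<in> TKer C"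
  shows "orthogonal C q m"
  unfolding orthogonal_def
proof (intro ballI impI)
  fix x y assume x: "x \<in> Hom C (Dom C q) (Dom C m)" and y: "y \<in> Hom C (Cod C q) (Cod C m)"
    and sq: "y \<cdot> q = m \<cdot> x"
  have q: "q \<in> Hom C (Dom C q) (Cod C q)" and m: "m \<in> Hom C (Dom C m) (Cod C m)"
    using qN mT NEpi_Mor TKer_Mor MorD by blast+
  obtain f where cok: "is_cokernel C q f"
    using qN unfolding NEpi_def by blast
  note f = cokernelD[OF cok q]
  have "zero_morphism C (m \<cdot> (x \<cdot> f))"
    using zero_morphism_comp_left[OF f(2) Comp_Hom[OF f(1) q] y]
      Comp_assoc[OF f(1) q y] Comp_assoc[OF f(1) x m] sq by metis
  then have "zero_morphism C (x \<cdot> f)"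
    using TKer_cancel_zero[OF mT m] Comp_Hom f x by blast
  then obtain d where d: "d \<in> Hom C (Cod C q) (Dom C m)" "d \<cdot> q = x"
    using cokernel_factor cok q x by blast
  have "m \<cdot> d = y"
    using cokernel_epic[OF cok q Comp_Hom[OF d(1) m] y] Comp_assoc[OF q d(1) m] d sq by metis
  then show "\<exists>!d. d \<in> Hom C (Cod C q) (Dom C m) \<and> d \<cdot> q = x \<and> m \<cdot> d = y"
    using d cokernel_epic[OF cok q] by metis
qed

lemma to_zero_object_NEpi:
  assumes "zero_object C Z" "t \<in> Hom C A Z"
  shows "t \<in> NEpi C"
proof -
  have A: "A \<in> Obj C"
    using HomD assms by blast
  have "is_cokernel C t (Id C A)"
  proof (rule cokernelI[OF Id_Hom[OF A] assms(2)])
    show "zero_morphism C (t \<cdot> Id C A)"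
      using zero_morphism_to_zero_object assms Id_right by metis
  next
    fix T g assume g: "g \<in> Hom C A T" "zero_morphism C (g \<cdot> Id C A)"
    obtain u where u: "u \<in> Hom C Z T"
      using from_zero_object assms HomD(5)[OF g(1)] by blast
    have "u \<cdot> t = g"
      using zero_morphism_unique[OF zero_morphismI[OF assms u] Comp_Hom[OF assms(2) u] _ g(1)]
        g Id_right by metis
    then show "\<exists>!u. u \<in> Hom C Z T \<and> u \<cdot> t = g"
      using u from_zero_object_unique assms by metis
  qed
  then show ?thesis
    unfolding NEpi_def by blast
qed

text \<open>
  If \<open>e\<close> is a cokernel of \<open>h\<close>, then \<open>h\<close> factors through \<open>k\<close>, so killing \<open>k\<close> implies killing \<open>h\<close>.
\<close>

lemma normal_epi_cokernel_of_kernel: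
  assumes eN: "e \<in> NEpi C" and e: "e \<in> Hom C A B" and k: "is_kernel C k e"
  shows "is_cokernel C e k"
proof -
  obtain h where cok: "is_cokernel C e h"
    using eN unfolding NEpi_def by blast
  note h = cokernelD[OF cok e] and k' = kernelD[OF k e]
  obtain u where u: "u \<in> Hom C (Dom C h) (Dom C k)" "k \<cdot> u = h"
    using kernel_factor k e h by blast
  show ?thesis
  proof (rule cokernelI[OF k'(1) e k'(2)])
    fix T g assume g: "g \<in> Hom C A T" "zero_morphism C (g \<cdot> k)"
    have "zero_morphism C (g \<cdot> h)"
      using zero_morphism_comp_right[OF g(2) u(1) Comp_Hom[OF k'(1) g(1)]]
        Comp_assoc[OF u(1) k'(1) g(1)] u by metis
    then show "\<exists>!u. u \<in> Hom C B T \<and> u \<cdot> e = g"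
      using cokernel_factor[OF cok e g(1)] cokernel_epic[OF cok e] by metis
  qed
qed

section \<open>Orthogonality and factorisations\<close>

lemma orthogonal_diagonal:
  assumes "orthogonal C e m" "e \<in> Hom C A B" "m \<in> Hom C A' B'"
    and "x \<in> Hom C A A'" "y \<in> Hom C B B'" "y \<cdot> e = m \<cdot> x"
  shows "\<exists>!d. d \<in> Hom C B A' \<and> d \<cdot> e = x \<and> m \<cdot> d = y"
  using assms HomD[OF assms(2)] HomD[OF assms(3)] unfolding orthogonal_def by metis

lemma factorisation:
  assumes "factorisation_system C E M" "f \<in> Hom C A B"
  obtains I e m where "e \<in> E" "m \<in> M" "e \<in> Hom C A I" "m \<in> Hom C I B" "f = m \<cdot> e"
proof -
  obtain e m where em: "e \<in> E" "m \<in> M" "Cod C e = Dom C m" "f = m \<cdot> e"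
    using assms HomD(1)[OF assms(2)] unfolding factorisation_system_def by metis
  have "e \<in> Mor C" "m \<in> Mor C"
    using assms(1) em unfolding factorisation_system_def by blast+
  then have e: "e \<in> Hom C (Dom C e) (Dom C m)" and m: "m \<in> Hom C (Dom C m) (Cod C m)"
    using em MorD by metis+
  then have "Dom C e = A" "Cod C m = B"
    using em HomD[OF assms(2)] HomD[OF Comp_Hom[OF e m]] by auto
  then show thesis
    using that em e m by blast
qed

lemma factorisation_system_orthogonal:
  "factorisation_system C E M \<Longrightarrow> e \<in> E \<Longrightarrow> m \<in> M \<Longrightarrow> orthogonal C e m"
  unfolding factorisation_system_def by blast

lemma factorisation_system_Mor:
  assumes "factorisation_system C E M"
  shows "E \<subseteq> Mor C" "M \<subseteq> Mor C"
  using assms unfolding factorisation_system_def by blast+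

text \<open>
  In a factorisation \<open>q = m \<cdot> e\<close>, the diagonal \<open>d\<close> of \<open>q\<close> against \<open>m\<close> is a section of \<open>m\<close>. Uniqueness of
  the diagonal of \<open>e\<close> against \<open>m\<close> makes it a two-sided inverse, so \<open>q\<close> is \<open>e\<close> up to an isomorphism.
\<close>

lemma left_class_if_orthogonal:
  assumes fs: "factorisation_system C E M" and q: "q \<in> Hom C A B"
    and orth: "\<And>m. m \<in> M \<Longrightarrow> orthogonal C q m"
  shows "q \<in> E"
proof -
  obtain I e m where em: "e \<in> E" "m \<in> M" "e \<in> Hom C A I" "m \<in> Hom C I B" "q = m \<cdot> e"
    by (rule factorisation[OF fs q])
  note B = HomD(5)[OF q] and I = HomD(4)[OF em(4)]
  have "Id C B \<cdot> q = m \<cdot> e"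
    using em q Id_left by metis
  then obtain d where d: "d \<in> Hom C B I" "d \<cdot> q = e" "m \<cdot> d = Id C B"
    using orthogonal_diagonal[OF orth[OF em(2)] q em(4,3) Id_Hom[OF B]] by blast
  have dm: "d \<cdot> m \<in> Hom C I I"
    using Comp_Hom em d by blast
  have "(d \<cdot> m) \<cdot> e = e"
    using Comp_assoc[OF em(3,4) d(1)] d em by metis
  moreover have "m \<cdot> (d \<cdot> m) = m"
    using Comp_assoc[OF em(4) d(1) em(4)] d em Id_left by metis
  moreover have "Id C I \<cdot> e = e" "m \<cdot> Id C I = m"
    using em Id_left Id_right by metis+
  ultimately have "d \<cdot> m = Id C I"
    using orthogonal_diagonal[OF factorisation_system_orthogonal[OF fs em(1,2)] em(3,4,3,4) refl]
      dm Id_Hom[OF I] by blast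
  then have "isomorphism C m"
    using d HomD[OF em(4)] unfolding isomorphism_def by auto
  then show ?thesis
    using fs em HomD[OF em(3)] HomD[OF em(4)] unfolding factorisation_system_def iso_closed_def
    by metis
qed

end

section \<open>Pullbacks from finite limits\<close>

text \<open>
  The free category on \<open>0 \<rightarrow> 2 \<leftarrow> 1\<close>. The morphisms \<open>0\<close>, \<open>1\<close>, \<open>2\<close> are the identities, \<open>3\<close> goes from \<open>0\<close>
  to \<open>2\<close> and \<open>4\<close> from \<open>1\<close> to \<open>2\<close>; in every composite at least one factor is an identity.
\<close>

definition cospan_shape :: "(nat, nat) cat" where
  "cospan_shape = \<lparr>Obj = {0, 1, 2}, Mor = {0, 1, 2, 3, 4},
    Dom = (\<lambda>u. if u = 3 then 0 else if u = 4 then 1 else u),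
    Cod = (\<lambda>u. if u < 3 then u else 2),
    Id = (\<lambda>i. i),
    Comp = (\<lambda>v u. if u < 3 then v else u)\<rparr>"

lemma category_cospan_shape: "category cospan_shape"
  by unfold_locales (auto simp: cospan_shape_def Hom_def split: if_splits)

lemma finite_cospan_shape: "finite (Obj cospan_shape)" "finite (Mor cospan_shape)"
  by (simp_all add: cospan_shape_def)

lemma (in category) pullback_if_finite_limits:
  assumes lim: "has_finite_limits C" and f: "f \<in> Hom C A D" and g: "g \<in> Hom C B D"
  shows "\<exists>p q. is_pullback C f g p q"
proof -
  let ?J = cospan_shape
  define Fo where "Fo = (\<lambda>i::nat. if i = 0 then A else if i = 1 then B else D)"
  define Fm where "Fm = (\<lambda>u::nat. if u = 3 then f else if u = 4 then g else Id C (Fo u))"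
  have obj: "A \<in> Obj C" "B \<in> Obj C" "D \<in> Obj C"
    using f g Dom_Obj Cod_Obj unfolding Hom_def by auto
  have "is_functor ?J C Fo Fm"
    using f g obj Id_Hom Id_left[OF f] Id_right[OF f] Id_left[OF g] Id_right[OF g]
      obj[THEN Id_Hom, THEN Id_left]
    unfolding is_functor_def by (auto simp: cospan_shape_def Fo_def Fm_def)
  then obtain P t where P: "is_limit ?J C Fo Fm P t"
    using lim category_cospan_shape finite_cospan_shape unfolding has_finite_limits_def by blast
  have cone: "is_cone ?J C Fo Fm T s \<longleftrightarrow>
    s 0 \<in> Hom C T A \<and> s 1 \<in> Hom C T B \<and> f \<cdot> s 0 = s 2 \<and> g \<cdot> s 1 = s 2" for T s
  proof -
    have "T \<in> Obj C \<and> s 2 \<in> Hom C T D" if "s 0 \<in> Hom C T A" "f \<cdot> s 0 = s 2"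
      using Comp_Hom[OF that(1) f] that Dom_Obj[of "s 0"] by (auto simp: Hom_def)
    then show ?thesis
      using Id_left[of "s 0" T A] Id_left[of "s 1" T B] Id_left[of "s 2" T D]
      unfolding is_cone_def by (auto simp: cospan_shape_def Fo_def Fm_def)
  qed
  have t: "t 0 \<in> Hom C P A" "t 1 \<in> Hom C P B" "f \<cdot> t 0 = g \<cdot> t 1" "f \<cdot> t 0 = t 2"
    using P unfolding is_limit_def cone by auto
  have "\<exists>!h. h \<in> Hom C T P \<and> t 0 \<cdot> h = a \<and> t 1 \<cdot> h = b"
    if a: "a \<in> Hom C T A" and b: "b \<in> Hom C T B" and eq: "f \<cdot> a = g \<cdot> b" for T a b
  proof -
    define s where "s = (\<lambda>i::nat. if i = 0 then a else if i = 1 then b else f \<cdot> a)"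
    have "is_cone ?J C Fo Fm T s"
      using a b eq unfolding cone s_def by simp
    then have "\<exists>!h. h \<in> Hom C T P \<and> (\<forall>i \<in> {0, 1, 2}. t i \<cdot> h = s i)"
      using P unfolding is_limit_def by (simp add: cospan_shape_def)
    moreover have "t 2 \<cdot> h = s 2" if "h \<in> Hom C T P" "t 0 \<cdot> h = a" for h
      using Comp_assoc[OF that(1) t(1) f] that t(4) by (simp add: s_def)
    ultimately show ?thesis
      by (simp add: s_def) metis
  qed
  moreover have "f \<in> Mor C" "Dom C f = A" "Cod C f = D" "g \<in> Mor C" "Dom C g = B" "Cod C g = D"
    "t 0 \<in> Mor C" "Dom C (t 0) = P" "Cod C (t 0) = A"
    "t 1 \<in> Mor C" "Dom C (t 1) = P" "Cod C (t 1) = B"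
    using f g t unfolding Hom_def by auto
  ultimately have "is_pullback C f g (t 0) (t 1)"
    using t unfolding is_pullback_def by simp
  then show ?thesis by blast
qed

locale pointed_cat_with_pullbacks = pointed_cat +
  assumes pullback_exists: "f \<in> Hom C A D \<Longrightarrow> g \<in> Hom C B D \<Longrightarrow> \<exists>p q. is_pullback C f g p q"
begin

lemma pullbackD:
  assumes "is_pullback C f g p q" "f \<in> Hom C A D" "g \<in> Hom C B D"
  shows "p \<in> Hom C (Dom C p) A" "q \<in> Hom C (Dom C p) B" "f \<cdot> p = g \<cdot> q"
  using assms unfolding is_pullback_def Hom_def by auto

lemma pullback_factor:
  assumes "is_pullback C f g p q" "f \<in> Hom C A D" "g \<in> Hom C B D"
    and "a \<in> Hom C T A" "b \<in> Hom C T B" "f \<cdot> a = g \<cdot> b"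
  shows "\<exists>!h. h \<in> Hom C T (Dom C p) \<and> p \<cdot> h = a \<and> q \<cdot> h = b"
  using assms HomD[OF assms(2)] HomD[OF assms(3)] HomD(4)[OF assms(4)]
  unfolding is_pullback_def by metis

text \<open>
  The kernel of \<open>f\<close> is its pullback along the morphism from a zero object.
\<close>

lemma kernel_exists:
  assumes f: "f \<in> Hom C A B"
  shows "\<exists>k. is_kernel C k f"
proof -
  obtain Z where Z: "zero_object C Z"
    using zero_object_exists by blast
  obtain z where z: "z \<in> Hom C Z B"
    using from_zero_object Z HomD(5)[OF f] by blast
  obtain k t where pb: "is_pullback C f z k t"
    using pullback_exists f z by blast
  note kt = pullbackD[OF pb f z]
  have "is_kernel C k f"
  proof (rule kernelI[OF kt(1) f])
    show "zero_morphism C (f \<cdot> k)"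
      using kt zero_morphismI Z z by metis
  next
    fix T g assume g: "g \<in> Hom C T A" "zero_morphism C (f \<cdot> g)"
    obtain b where b: "b \<in> Hom C T Z"
      using to_zero_object Z HomD(4)[OF g(1)] by blast
    have "f \<cdot> g = z \<cdot> b"
      using zero_morphism_unique[OF g(2) Comp_Hom[OF g(1) f] zero_morphismI[OF Z b z]
          Comp_Hom[OF b z]] .
    then have "\<exists>!u. u \<in> Hom C T (Dom C k) \<and> k \<cdot> u = g \<and> t \<cdot> u = b"
      using pullback_factor[OF pb f z g(1) b] by blast
    moreover have "t \<cdot> u = b" if "u \<in> Hom C T (Dom C k)" for u
      using that to_zero_object_unique Z b kt Comp_Hom by metis
    ultimately show "\<exists>!u. u \<in> Hom C T (Dom C k) \<and> k \<cdot> u = g"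
      by metis
  qed
  then show ?thesis by blast
qed

text \<open>
  A binary product is a pullback over a zero object.
\<close>

lemma product_exists:
  assumes "A \<in> Obj C" "B \<in> Obj C"
  obtains P p q where "p \<in> Hom C P A" "q \<in> Hom C P B"
    and "\<And>T a b. a \<in> Hom C T A \<Longrightarrow> b \<in> Hom C T B \<Longrightarrow>
      \<exists>!h. h \<in> Hom C T P \<and> p \<cdot> h = a \<and> q \<cdot> h = b"
proof -
  obtain Z where Z: "zero_object C Z"
    using zero_object_exists by blast
  obtain s t where s: "s \<in> Hom C A Z" and t: "t \<in> Hom C B Z"
    using to_zero_object Z assms by blast
  obtain p q where pb: "is_pullback C s t p q"
    using pullback_exists s t by blast
  have "\<exists>!h. h \<in> Hom C T (Dom C p) \<and> p \<cdot> h = a \<and> q \<cdot> h = b"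
    if a: "a \<in> Hom C T A" and b: "b \<in> Hom C T B" for T a b
    using pullback_factor[OF pb s t a b] to_zero_object_unique[OF Z Comp_Hom[OF a s] Comp_Hom[OF b t]]
    by blast
  then show thesis
    using that pullbackD[OF pb s t] by blast
qed

section \<open>Stable factorisation systems and prenormality\<close>

lemma pullback_stableD:
  "pullback_stable C S \<Longrightarrow> f \<in> S \<Longrightarrow> is_pullback C f g p q \<Longrightarrow> q \<in> S"
  unfolding pullback_stable_def by blast

lemma TKer_if_kernel_zero:
  assumes m: "m \<in> Hom C A B" and k: "is_kernel C l m" and l: "zero_morphism C (Id C (Dom C l))"
  shows "m \<in> TKer C"
  using zero_object_if_zero_Id k l HomD(4)[OF kernelD(1)[OF k m]] unfolding TKer_def by blast

text \<open>
  Stability is what makes this work: it turns the zero morphism \<open>q\<close>, the pullback of \<open>e\<close> along the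
  kernel \<open>l\<close> of \<open>m\<close>, into an epimorphism, so that the identity of the domain of \<open>l\<close> is zero.
\<close>

lemma cokernel_of_kernel_comparison_TKer:
  assumes stable: "pullback_stable C (NEpi C)"
    and f: "f \<in> Hom C A B" and k: "is_kernel C k f"
    and e: "e \<in> Hom C A I" and cok: "is_cokernel C e k"
    and m: "m \<in> Hom C I B" and fme: "f = m \<cdot> e"
  shows "m \<in> TKer C"
proof -
  obtain l where l: "is_kernel C l m"
    using kernel_exists m by blast
  note l' = kernelD[OF l m]
  obtain p q where pb: "is_pullback C e l p q"
    using pullback_exists e l' by blast
  note pq = pullbackD[OF pb e l'(1)] and k' = kernelD[OF k f]
  have "q \<in> NEpi C"
    using pullback_stableD stable pb cok unfolding NEpi_def by blast
  then obtain h where h: "is_cokernel C q h"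
    unfolding NEpi_def by blast
  have "f \<cdot> p = (m \<cdot> l) \<cdot> q"
    using fme Comp_assoc[OF pq(1) e m] Comp_assoc[OF pq(2) l'(1) m] pq by metis
  then have "zero_morphism C (f \<cdot> p)"
    using zero_morphism_comp_right[OF l'(2) pq(2) Comp_Hom[OF l'(1) m]] by metis
  then obtain u where u: "u \<in> Hom C (Dom C p) (Dom C k)" "k \<cdot> u = p"
    using kernel_factor k f pq by blast
  have "zero_morphism C (l \<cdot> q)"
    using zero_morphism_comp_right[OF cokernelD(2)[OF cok e] u(1) Comp_Hom[OF k'(1) e]]
      Comp_assoc[OF u(1) k'(1) e] u pq by metis
  then have q0: "zero_morphism C q"
    using kernel_cancel_zero l m pq by blast
  have L: "Dom C l \<in> Obj C"
    using HomD l' by blast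
  obtain z where z: "z \<in> Hom C (Dom C l) (Dom C l)" "zero_morphism C z"
    using zero_morphism_exists L by blast
  have "z \<cdot> q = Id C (Dom C l) \<cdot> q"
    using zero_morphism_unique zero_morphism_comp_left q0 pq z Id_Hom[OF L] Comp_Hom by metis
  then have "z = Id C (Dom C l)"
    using cokernel_epic[OF h pq(2) z(1) Id_Hom[OF L]] by blast
  then show ?thesis
    using TKer_if_kernel_zero m l z by metis
qed

lemma prenormal_imp_stable_factorisation_system:
  assumes cok: "\<And>k f. is_kernel C k f \<Longrightarrow> \<exists>q. is_cokernel C q k"
    and stable: "pullback_stable C (NEpi C)"
  shows "stable_factorisation_system C (NEpi C) (TKer C)"
proof -
  have "\<exists>e \<in> NEpi C. \<exists>m \<in> TKer C. Cod C e = Dom C m \<and> f = m \<cdot> e" if "f \<in> Mor C" for f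
  proof -
    have f: "f \<in> Hom C (Dom C f) (Cod C f)"
      using that MorD by blast
    obtain k where k: "is_kernel C k f"
      using kernel_exists f by blast
    obtain e where e: "is_cokernel C e k"
      using cok k by blast
    have e': "e \<in> Hom C (Dom C f) (Cod C e)"
      using e k unfolding is_cokernel_def is_kernel_def Hom_def by auto
    obtain m where m: "m \<in> Hom C (Cod C e) (Cod C f)" "m \<cdot> e = f"
      using cokernel_factor e e' f kernelD k by blast
    have "e \<in> NEpi C"
      using e unfolding NEpi_def by blast
    then show ?thesis
      using cokernel_of_kernel_comparison_TKer[OF stable f k e' e m(1) m(2)[symmetric]]
        m(2) HomD(2)[OF m(1)] by metis
  qed
  then show ?thesis
    unfolding stable_factorisation_system_def factorisation_system_def
    using stable NEpi_Mor TKer_Mor iso_closed_NEpi iso_closed_TKer NEpi_orthogonal_TKer by blast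
qed

text \<open>
  Let \<open>l\<close> be a kernel of \<open>m\<close>. As \<open>m \<cdot> l\<close> is zero, \<open>l\<close> is the top edge of a square whose left
  edge is the normal epimorphism to a zero object and whose right edge is \<open>m\<close>.
  Its diagonal exhibits \<open>l\<close> as a zero morphism; being monic, \<open>l\<close> has a zero domain.
\<close>

lemma right_class_of_NEpi_subset_TKer:
  assumes fs: "factorisation_system C (NEpi C) M"
  shows "M \<subseteq> TKer C"
proof
  fix m assume mM: "m \<in> M"
  then have m: "m \<in> Hom C (Dom C m) (Cod C m)"
    using factorisation_system_Mor fs MorD by blast
  obtain l where l: "is_kernel C l m"
    using kernel_exists m by blast
  note l' = kernelD[OF l m]
  have L: "Dom C l \<in> Obj C"
    using HomD l' by blast
  obtain Z where Z: "zero_object C Z"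
    using zero_object_exists by blast
  obtain t z where t: "t \<in> Hom C (Dom C l) Z" and z: "z \<in> Hom C Z (Cod C m)"
    using to_zero_object from_zero_object Z L HomD(5)[OF m] by blast
  have "z \<cdot> t = m \<cdot> l"
    using zero_morphism_unique[OF zero_morphismI[OF Z t z] Comp_Hom[OF t z] l'(2)
        Comp_Hom[OF l'(1) m]] .
  then obtain d where d: "d \<in> Hom C Z (Dom C m)" "d \<cdot> t = l"
    using orthogonal_diagonal[OF
        factorisation_system_orthogonal[OF fs to_zero_object_NEpi[OF Z t] mM] t m l'(1) z]
    by blast
  have "zero_morphism C (l \<cdot> Id C (Dom C l))"
    using zero_morphismI[OF Z t d(1)] d Id_right[OF l'(1)] by simp
  then have "zero_morphism C (Id C (Dom C l))"
    using kernel_cancel_zero[OF l m Id_Hom[OF L]] by blast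
  then show "m \<in> TKer C"
    using TKer_if_kernel_zero m l by blast
qed

text \<open>
  The left factor \<open>e\<close> of \<open>f\<close> is the required cokernel: \<open>f\<close> and \<open>e\<close> kill the same morphisms, since the
  right factor has trivial kernel.
\<close>

lemma cokernel_of_kernel_if_NEpi_left_class:
  assumes fs: "factorisation_system C (NEpi C) M" and k: "is_kernel C k f"
  shows "\<exists>q. is_cokernel C q k"
proof -
  have f: "f \<in> Hom C (Dom C f) (Cod C f)"
    using k MorD unfolding is_kernel_def by blast
  obtain I e m where em: "e \<in> NEpi C" "m \<in> M" "e \<in> Hom C (Dom C f) I" "m \<in> Hom C I (Cod C f)"
    "f = m \<cdot> e"
    by (rule factorisation[OF fs f])
  have mT: "m \<in> TKer C"
    using right_class_of_NEpi_subset_TKer fs em by blast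
  note k' = kernelD[OF k f]
  have "is_kernel C k e"
  proof (rule kernelI[OF k'(1) em(3)])
    show "zero_morphism C (e \<cdot> k)"
      using TKer_cancel_zero[OF mT em(4) Comp_Hom[OF k'(1) em(3)]]
        Comp_assoc[OF k'(1) em(3,4)] k' em by metis
  next
    fix T g assume g: "g \<in> Hom C T (Dom C f)" "zero_morphism C (e \<cdot> g)"
    have "zero_morphism C (f \<cdot> g)"
      using zero_morphism_comp_left[OF g(2) Comp_Hom[OF g(1) em(3)] em(4)]
        Comp_assoc[OF g(1) em(3,4)] em by metis
    then show "\<exists>!u. u \<in> Hom C T (Dom C k) \<and> k \<cdot> u = g"
      using kernel_factor[OF k f g(1)] kernel_monic[OF k f] by metis
  qed
  then show ?thesis
    using normal_epi_cokernel_of_kernel em by blast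
qed

text \<open>
  The morphism \<open>z\<close> from a zero object to \<open>L\<close> is monic, hence in the right class. A zero morphism \<open>e\<close>
  factors through it, so orthogonality provides a section of \<open>z\<close>.
\<close>

lemma left_class_of_TKer_zero:
  assumes fs: "factorisation_system C E (TKer C)"
    and eE: "e \<in> E" and e: "e \<in> Hom C A L" and e0: "zero_morphism C e"
  shows "zero_morphism C (Id C L)"
proof -
  note A = HomD(4)[OF e] and L = HomD(5)[OF e]
  obtain Z where Z: "zero_object C Z"
    using zero_object_exists by blast
  obtain z where z: "z \<in> Hom C Z L"
    using from_zero_object Z L by blast
  obtain x where x: "x \<in> Hom C A Z"
    using to_zero_object Z A by blast
  have zT: "z \<in> TKer C"
    using monic_in_TKer z to_zero_object_unique Z by blast
  have "Id C L \<cdot> e = z \<cdot> x"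
    using Id_left[OF e] zero_morphism_unique[OF e0 e zero_morphismI[OF Z x z] Comp_Hom[OF x z]]
    by simp
  then obtain d where "d \<in> Hom C L Z" "z \<cdot> d = Id C L"
    using orthogonal_diagonal[OF factorisation_system_orthogonal[OF fs eE zT] e z x Id_Hom[OF L]]
    by blast
  then show ?thesis
    using zero_morphismI Z z by metis
qed

text \<open>
  The graph of \<open>u\<close>, the morphism \<open>m\<close> with components \<open>Id\<close> and \<open>u\<close>, is monic, hence in the right class.
  If \<open>u \<cdot> e = v \<cdot> e\<close>, the graphs of \<open>u\<close> and \<open>v\<close> agree after \<open>e\<close>, and the diagonal factors the graph of
  \<open>v\<close> through that of \<open>u\<close>; the first components force the factor to be the identity.
\<close>

lemma left_class_of_TKer_epic:
  assumes fs: "factorisation_system C E (TKer C)"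
    and eE: "e \<in> E" and e: "e \<in> Hom C A B"
    and u: "u \<in> Hom C B D" and v: "v \<in> Hom C B D" and eq: "u \<cdot> e = v \<cdot> e"
  shows "u = v"
proof -
  note B = HomD(5)[OF e] and D = HomD(5)[OF u]
  obtain P p q where p: "p \<in> Hom C P B" and q: "q \<in> Hom C P D"
    and pair: "\<And>T a b. a \<in> Hom C T B \<Longrightarrow> b \<in> Hom C T D \<Longrightarrow>
      \<exists>!h. h \<in> Hom C T P \<and> p \<cdot> h = a \<and> q \<cdot> h = b"
    by (rule product_exists[OF B D], rule that)
  obtain m where m: "m \<in> Hom C B P" "p \<cdot> m = Id C B" "q \<cdot> m = u"
    using pair[OF Id_Hom[OF B] u] by blast
  obtain n where n: "n \<in> Hom C B P" "p \<cdot> n = Id C B" "q \<cdot> n = v"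
    using pair[OF Id_Hom[OF B] v] by blast
  have pm: "p \<cdot> (m \<cdot> w) = w" if "w \<in> Hom C T B" for T w
    using Comp_assoc[OF that m(1) p] m that Id_left by metis
  have mT: "m \<in> TKer C"
    using monic_in_TKer[OF m(1)] pm by metis
  have me: "m \<cdot> e \<in> Hom C A P" and ne: "n \<cdot> e \<in> Hom C A P"
    using Comp_Hom e m n by blast+
  have "p \<cdot> (m \<cdot> e) = e" "p \<cdot> (n \<cdot> e) = e"
    using Comp_assoc[OF e m(1) p] Comp_assoc[OF e n(1) p] m n e Id_left by metis+
  moreover have "q \<cdot> (m \<cdot> e) = u \<cdot> e" "q \<cdot> (n \<cdot> e) = u \<cdot> e"
    using Comp_assoc[OF e m(1) q] Comp_assoc[OF e n(1) q] m n eq by metis+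
  ultimately have "n \<cdot> e = m \<cdot> e"
    using pair[OF e Comp_Hom[OF e u]] me ne by blast
  then obtain d where d: "d \<in> Hom C B B" "m \<cdot> d = n"
    using orthogonal_diagonal[OF factorisation_system_orthogonal[OF fs eE mT] e m(1) e n(1)] by blast
  have "d = Id C B"
    using pm d n by metis
  then show ?thesis
    using d m n Id_right by metis
qed

text \<open>
  To extend \<open>g\<close> along \<open>e\<close> one looks for the image of the pair \<open>(e, g)\<close>, the graph of the extension. It
  is a graph as soon as its first component \<open>a\<close> has trivial kernel, which is where stability of \<open>E\<close> and
  the hypothesis that \<open>g\<close> kills the kernel of \<open>e\<close> enter.
\<close>

lemma left_class_of_TKer_subset_NEpi:
  assumes fs: "factorisation_system C E (TKer C)" and stable: "pullback_stable C E"
  shows "E \<subseteq> NEpi C"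
proof
  fix e assume eE: "e \<in> E"
  define A where "A = Dom C e"
  define B where "B = Cod C e"
  have e: "e \<in> Hom C A B"
    using factorisation_system_Mor fs eE MorD unfolding A_def B_def by blast
  note B = HomD(5)[OF e]
  obtain k where k: "is_kernel C k e"
    using kernel_exists e by blast
  note k' = kernelD[OF k e]
  have "is_cokernel C e k"
  proof (rule cokernelI[OF k'(1) e k'(2)])
    fix D g assume g: "g \<in> Hom C A D" "zero_morphism C (g \<cdot> k)"
    note D = HomD(5)[OF g(1)]
    obtain P p q where p: "p \<in> Hom C P B" and q: "q \<in> Hom C P D"
      and pair: "\<And>T a b. a \<in> Hom C T B \<Longrightarrow> b \<in> Hom C T D \<Longrightarrow>
        \<exists>!h. h \<in> Hom C T P \<and> p \<cdot> h = a \<and> q \<cdot> h = b"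
      by (rule product_exists[OF B D], rule that)
    obtain w where w: "w \<in> Hom C A P" "p \<cdot> w = e" "q \<cdot> w = g"
      using pair[OF e g(1)] by blast
    obtain I c m where c: "c \<in> E" "c \<in> Hom C A I" and m: "m \<in> TKer C" "m \<in> Hom C I P"
      and wmc: "w = m \<cdot> c"
      using factorisation[OF fs w(1)] by metis
    define a where "a = p \<cdot> m"
    define b where "b = q \<cdot> m"
    have a: "a \<in> Hom C I B" and b: "b \<in> Hom C I D"
      using Comp_Hom m p q unfolding a_def b_def by blast+
    have ac: "a \<cdot> c = e" and bc: "b \<cdot> c = g"
      using Comp_assoc[OF c(2) m(2) p] Comp_assoc[OF c(2) m(2) q] w wmc
      unfolding a_def b_def by metis+
    obtain l where l: "is_kernel C l a"
      using kernel_exists a by blast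
    note l' = kernelD[OF l a]
    \<comment> \<open>On the pullback of \<open>c\<close> along the kernel of \<open>a\<close>, both \<open>e\<close> and \<open>g\<close> vanish; so does the pair
      \<open>w = m \<cdot> c\<close>, and \<open>m\<close> reflects this: \<open>l \<cdot> s\<close> is zero.\<close>
    obtain r s where pb: "is_pullback C c l r s"
      using pullback_exists c l' by blast
    note rs = pullbackD[OF pb c(2) l'(1)]
    have sE: "s \<in> E"
      using pullback_stableD stable c pb by blast
    have ls: "l \<cdot> s \<in> Hom C (Dom C r) I"
      using Comp_Hom rs l' by blast
    have als: "zero_morphism C (a \<cdot> (l \<cdot> s))"
      using zero_morphism_comp_right[OF l'(2) rs(2) Comp_Hom[OF l'(1) a]]
        Comp_assoc[OF rs(2) l'(1) a] by metis
    have "a \<cdot> (l \<cdot> s) = e \<cdot> r"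
      using Comp_assoc[OF rs(1) c(2) a] rs ac by metis
    then obtain v where v: "v \<in> Hom C (Dom C r) (Dom C k)" "k \<cdot> v = r"
      using kernel_factor[OF k e rs(1)] als by metis
    have "b \<cdot> (l \<cdot> s) = (g \<cdot> k) \<cdot> v"
      using Comp_assoc[OF rs(1) c(2) b] Comp_assoc[OF v(1) k'(1) g(1)] rs bc v by metis
    then have bls: "zero_morphism C (b \<cdot> (l \<cdot> s))"
      using zero_morphism_comp_right[OF g(2) v(1) Comp_Hom[OF k'(1) g(1)]] by metis
    have mls: "m \<cdot> (l \<cdot> s) \<in> Hom C (Dom C r) P"
      using Comp_Hom m ls by blast
    obtain z where z: "z \<in> Hom C (Dom C r) P" "zero_morphism C z"
      using zero_morphism_exists HomD(4,5)[OF mls] by blast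
    have "p \<cdot> (m \<cdot> (l \<cdot> s)) = p \<cdot> z"
      using zero_morphism_unique[OF als Comp_Hom[OF ls a] zero_morphism_comp_left[OF z(2,1) p]
          Comp_Hom[OF z(1) p]] Comp_assoc[OF ls m(2) p] unfolding a_def by simp
    moreover have "q \<cdot> (m \<cdot> (l \<cdot> s)) = q \<cdot> z"
      using zero_morphism_unique[OF bls Comp_Hom[OF ls b] zero_morphism_comp_left[OF z(2,1) q]
          Comp_Hom[OF z(1) q]] Comp_assoc[OF ls m(2) q] unfolding b_def by simp
    ultimately have "m \<cdot> (l \<cdot> s) = z"
      using pair[OF Comp_Hom[OF z(1) p] Comp_Hom[OF z(1) q]] mls z by blast
    then have "zero_morphism C (l \<cdot> s)"
      using TKer_cancel_zero m ls z by metis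
    then have "zero_morphism C s"
      using kernel_cancel_zero l a rs by blast
    then have "zero_morphism C (Id C (Dom C l))"
      using left_class_of_TKer_zero fs sE rs by blast
    then have aT: "a \<in> TKer C"
      using TKer_if_kernel_zero a l by blast
    have "Id C B \<cdot> e = a \<cdot> c"
      using Id_left e ac by metis
    then obtain d where d: "d \<in> Hom C B I" "d \<cdot> e = c"
      using orthogonal_diagonal[OF factorisation_system_orthogonal[OF fs eE aT] e a c(2) Id_Hom[OF B]]
      by blast
    have "(b \<cdot> d) \<cdot> e = g" "b \<cdot> d \<in> Hom C B D"
      using Comp_assoc[OF e d(1) b] d bc Comp_Hom b by metis+
    then show "\<exists>!u. u \<in> Hom C B D \<and> u \<cdot> e = g"
      using left_class_of_TKer_epic[OF fs eE e] by metis
  qed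
  then show "e \<in> NEpi C"
    unfolding NEpi_def by blast
qed

lemma left_class_of_TKer_eq_NEpi:
  assumes fs: "factorisation_system C E (TKer C)" and stable: "pullback_stable C E"
  shows "E = NEpi C"
proof
  show "E \<subseteq> NEpi C"
    using left_class_of_TKer_subset_NEpi fs stable .
  show "NEpi C \<subseteq> E"
    using left_class_if_orthogonal[OF fs] NEpi_orthogonal_TKer NEpi_Mor MorD by blast
qed

end

theorem proposition2p4:
  fixes C :: "('o, 'm) cat"
  assumes "pointed_category C" and "has_finite_limits C"
  shows "(prenormal C \<longleftrightarrow> stable_factorisation_system C (NEpi C) (TKer C)) \<and>
    (stable_factorisation_system C (NEpi C) (TKer C) \<longleftrightarrow>
      (\<exists>M. stable_factorisation_system C (NEpi C) M)) \<and>
    ((\<exists>M. stable_factorisation_system C (NEpi C) M) \<longleftrightarrow>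
      (\<exists>E. stable_factorisation_system C E (TKer C)))"
proof -
  interpret category C
    using assms(1) unfolding pointed_category_def by blast
  interpret pointed_cat_with_pullbacks C
    using assms pullback_if_finite_limits unfolding pointed_category_def
    by unfold_locales blast+
  have i_ii: "stable_factorisation_system C (NEpi C) (TKer C)" if "prenormal C"
    using that prenormal_imp_stable_factorisation_system unfolding prenormal_def by blast
  have iii_i: "prenormal C" if "stable_factorisation_system C (NEpi C) M" for M
    using that assms cokernel_of_kernel_if_NEpi_left_class
    unfolding prenormal_def stable_factorisation_system_def by blast
  have iv_ii: "stable_factorisation_system C (NEpi C) (TKer C)"
    if "stable_factorisation_system C E (TKer C)" for E
    using that left_class_of_TKer_eq_NEpi unfolding stable_factorisation_system_def by blast
  show ?thesis
    using i_ii iii_i iv_ii by blast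
qed

end
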